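(* None of the following graph polynomials is a Harary polynomial, i.e., for each $F$ among them there is no graph property $\mathcal{P}$ with $\chi_{\mathcal{P}}(G;x)=F(G;x)$ for all graphs $G$: (i) the characteristic polynomial $char(G;x)$ and the Laplacian polynomial $Lap(G;x)$; (ii) the generating matching polynomial $M(G;x)$ and the matching defect polynomial $\mu(G;x)$; (iii) the independence polynomial $IND(G;x)$; (iv) the domination polynomial $DOM(G;x)$.
   Context: All graphs are finite simple graphs; a graph property is a class of graphs closed under isomorphism. For a graph property $\mathcal{P}$ and graph $G$, $b_i^{\mathcal{P}}(G)$ is the number of partitions of $V(G)$ into $i$ nonempty blocks each inducing a graph in $\mathcal{P}$, and $\chi_{\mathcal{P}}(G;x)=\sum_i b_i^{\mathcal{P}}(G)\,x_{(i)}$ with $x_{(i)}=x(x-1)\cdots(x-i+1)$. For a graph $G$ of order $n$: $char(G;x)$ is the characteristic polynomial of the adjacency matrix of $G$, and $Lap(G;x)$ the characteristic polynomial of its Laplacian matrix. With $m_i(G)$ the number of matchings of $G$ with $i$ edges, $M(G;x)=\sum_i m_i(G)x^i$ and $\mu(G;x)=\sum_i(-1)^i m_i(G)x^{n-2i}$. With $in_i(G)$ the number of independent sets of size $i$ and $d_i(G)$ the number of dominating sets of size $i$, $IND(G;x)=\sum_i in_i(G)x^i$ and $DOM(G;x)=\sum_i d_i(G)x^i$. *)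

theory Defs
  imports
    "Graph_Theory.Digraph_Isomorphism"
    "Jordan_Normal_Form.Char_Poly"
    "HOL-Library.Disjoint_Sets"
begin

text \<open>
  Finite simple graphs are given by the locale \<open>Digraph.graph\<close>: finite symmetric digraphs without
  loops and parallel arcs, so that an edge between u and v is a pair of opposite arcs, and
  \<open>u \<rightarrow>\<^bsub>G\<^esub> v\<close> is adjacency. HOL has no type of all graphs; since every finite graph is isomorphic
  to one with vertices in \<open>nat\<close> and arcs in \<open>nat \<times> nat\<close>, a class of graphs closed under isomorphism
  is represented by its members over these types. The graph of order 0 is included.
\<close>

type_synonym nat_graph = "(nat, nat \<times> nat) pre_digraph"

definition graph_property :: "nat_graph set \<Rightarrow> bool" where
  "graph_property P \<longleftrightarrow>
     (\<forall>G\<in>P. Digraph.graph G) \<and> (\<forall>G\<in>P. \<forall>H :: nat_graph. digraph_iso G H \<longrightarrow> H \<in> P)"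

definition harary_coeff :: "('a, 'b) pre_digraph set \<Rightarrow> ('a, 'b) pre_digraph \<Rightarrow> nat \<Rightarrow> nat" where
  "harary_coeff P G i =
     card {Q. partition_on (verts G) Q \<and> card Q = i \<and> (\<forall>B\<in>Q. G \<restriction> B \<in> P)}"

definition falling_factorial_poly :: "nat \<Rightarrow> int poly" where
  "falling_factorial_poly i = (\<Prod>k<i. [:- int k, 1:])"

definition harary_poly :: "('a, 'b) pre_digraph set \<Rightarrow> ('a, 'b) pre_digraph \<Rightarrow> int poly" where
  "harary_poly P G =
     (\<Sum>i\<le>card (verts G). Polynomial.smult (int (harary_coeff P G i)) (falling_factorial_poly i))"

definition is_harary_polynomial :: "(nat_graph \<Rightarrow> int poly) \<Rightarrow> bool" where
  "is_harary_polynomial F \<longleftrightarrow>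
     (\<exists>P. graph_property P \<and> (\<forall>G. Digraph.graph G \<longrightarrow> harary_poly P G = F G))"

text \<open>
  Rows and columns are indexed by the vertices in increasing order. Another order conjugates the
  matrices below by a permutation matrix and does not change their characteristic polynomials.
\<close>

definition vertex_list :: "('a::linorder, 'b) pre_digraph \<Rightarrow> 'a list" where
  "vertex_list G = sorted_list_of_set (verts G)"

definition adjacency_mat :: "('a::linorder, 'b) pre_digraph \<Rightarrow> int mat" where
  "adjacency_mat G = mat (card (verts G)) (card (verts G))
     (\<lambda>(i, j). if vertex_list G ! i \<rightarrow>\<^bsub>G\<^esub> vertex_list G ! j then 1 else 0)"

definition degree_mat :: "('a::linorder, 'b) pre_digraph \<Rightarrow> int mat" where
  "degree_mat G = mat (card (verts G)) (card (verts G))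
     (\<lambda>(i, j). if i = j then int (out_degree G (vertex_list G ! i)) else 0)"

definition laplacian_mat :: "('a::linorder, 'b) pre_digraph \<Rightarrow> int mat" where
  "laplacian_mat G = degree_mat G - adjacency_mat G"

definition characteristic_poly :: "('a::linorder, 'b) pre_digraph \<Rightarrow> int poly" where
  "characteristic_poly G = char_poly (adjacency_mat G)"

definition laplacian_poly :: "('a::linorder, 'b) pre_digraph \<Rightarrow> int poly" where
  "laplacian_poly G = char_poly (laplacian_mat G)"

definition undirected_edges :: "('a, 'b) pre_digraph \<Rightarrow> 'a set set" where
  "undirected_edges G = {{u, v} | u v. u \<rightarrow>\<^bsub>G\<^esub> v}"

definition matching_count :: "('a, 'b) pre_digraph \<Rightarrow> nat \<Rightarrow> nat" where
  "matching_count G i = card {M. M \<subseteq> undirected_edges G \<and> disjoint M \<and> card M = i}"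

definition generating_matching_poly :: "('a, 'b) pre_digraph \<Rightarrow> int poly" where
  "generating_matching_poly G =
     (\<Sum>i\<le>card (undirected_edges G). monom (int (matching_count G i)) i)"

text \<open>
  A matching with i edges covers \<open>2 * i\<close> vertices; the bound loses no term and keeps the
  subtraction in the exponent from truncating.
\<close>

definition matching_defect_poly :: "('a, 'b) pre_digraph \<Rightarrow> int poly" where
  "matching_defect_poly G =
     (\<Sum>i\<le>card (verts G) div 2.
        monom ((-1) ^ i * int (matching_count G i)) (card (verts G) - 2 * i))"

definition independent_set :: "('a, 'b) pre_digraph \<Rightarrow> 'a set \<Rightarrow> bool" where
  "independent_set G S \<longleftrightarrow> S \<subseteq> verts G \<and> (\<forall>u\<in>S. \<forall>v\<in>S. \<not> u \<rightarrow>\<^bsub>G\<^esub> v)"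

definition independence_poly :: "('a, 'b) pre_digraph \<Rightarrow> int poly" where
  "independence_poly G =
     (\<Sum>i\<le>card (verts G). monom (int (card {S. independent_set G S \<and> card S = i})) i)"

definition dominating_set :: "('a, 'b) pre_digraph \<Rightarrow> 'a set \<Rightarrow> bool" where
  "dominating_set G S \<longleftrightarrow> S \<subseteq> verts G \<and> (\<forall>v\<in>verts G - S. \<exists>u\<in>S. u \<rightarrow>\<^bsub>G\<^esub> v)"

definition domination_poly :: "('a, 'b) pre_digraph \<Rightarrow> int poly" where
  "domination_poly G =
     (\<Sum>i\<le>card (verts G). monom (int (card {S. dominating_set G S \<and> card S = i})) i)"

end

theory Submission
  imports Defs
begin

text \<open>
  For a graph with at least one vertex, a Harary polynomial vanishes at 0, and its value at 1 is
  the number of admissible partitions into a single block, hence at most 1. The complete graph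
  with two vertices violates the first condition for \<open>char\<close>, \<open>M\<close>, \<open>\<mu>\<close> and \<open>IND\<close>. It violates the
  second for \<open>DOM\<close> (value 3) and, since values at 1 are also nonnegative, for \<open>Lap\<close> (value -1).
\<close>

text \<open>The factor with index \<open>k\<close> belongs to the product and has root
  \<open>int k\<close>.\<close>

lemma poly_falling_factorial_eq_0:
  assumes "k < i"
  shows "poly (falling_factorial_poly i) (int k) = 0"
  using assms by (auto simp: falling_factorial_poly_def poly_prod)

lemma harary_coeff_0:
  assumes "finite (verts G)" "verts G \<noteq> {}"
  shows "harary_coeff P G 0 = 0"
proof -
  \<comment> \<open>Since \<open>card\<close> is 0 on infinite sets as well, \<open>Q\<close> must
    be shown finite, not only nonempty.\<close>
  have "card Q \<noteq> 0" if "partition_on (verts G) Q" for Q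
    using that assms finite_elements[OF assms(1) that] by (auto simp: partition_on_def)
  then have "{Q. partition_on (verts G) Q \<and> card Q = 0 \<and> (\<forall>B\<in>Q. G \<restriction> B \<in> P)} = {}"
    by blast
  then show ?thesis
    by (simp only: harary_coeff_def card.empty)
qed

lemma harary_coeff_1_le: "harary_coeff P G 1 \<le> 1"
proof -
  have "{Q. partition_on (verts G) Q \<and> card Q = 1 \<and> (\<forall>B\<in>Q. G \<restriction> B \<in> P)} \<subseteq> {{verts G}}"
    by (auto simp: partition_on_def card_1_singleton_iff)
  from card_mono[OF _ this] show ?thesis
    by (simp add: harary_coeff_def)
qed

text \<open>Every summand vanishes at 0: the one with \<open>i = 0\<close> through its coefficient,
  the others through their falling factorial.\<close>

lemma poly_harary_poly_0:
  assumes "finite (verts G)" "verts G \<noteq> {}"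
  shows "poly (harary_poly P G) 0 = 0"
proof -
  have "int (harary_coeff P G i) * poly (falling_factorial_poly i) 0 = 0" for i
    using harary_coeff_0[OF assms] poly_falling_factorial_eq_0[of 0 i] by (cases i) auto
  then show ?thesis
    by (simp only: harary_poly_def poly_sum poly_smult sum.neutral_const)
qed

text \<open>Falling factorials with \<open>i > 1\<close> have root 1 and the coefficient at
  \<open>i = 0\<close> is zero. Only \<open>i = 1\<close> survives, where the falling factorial is
  x.\<close>

lemma poly_harary_poly_1:
  assumes "finite (verts G)" "verts G \<noteq> {}"
  shows "poly (harary_poly P G) 1 = int (harary_coeff P G 1)"
proof -
  have "poly (harary_poly P G) 1 =
      (\<Sum>i\<le>card (verts G). int (harary_coeff P G i) * poly (falling_factorial_poly i) 1)"
    by (simp add: harary_poly_def poly_sum)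
  also have "\<dots> = (\<Sum>i\<in>{1}. int (harary_coeff P G i) * poly (falling_factorial_poly i) 1)"
  proof (rule sum.mono_neutral_right)
    show "{1} \<subseteq> {..card (verts G)}"
      using assms by (simp add: Suc_le_eq card_gt_0_iff)
    show "\<forall>i\<in>{..card (verts G)} - {1}.
        int (harary_coeff P G i) * poly (falling_factorial_poly i) 1 = 0"
    proof
      fix i assume "i \<in> {..card (verts G)} - {1}"
      then have "i = 0 \<or> 1 < i" by auto
      then show "int (harary_coeff P G i) * poly (falling_factorial_poly i) 1 = 0"
        using harary_coeff_0[OF assms] poly_falling_factorial_eq_0[of 1 i] by auto
    qed
  qed simp
  also have "\<dots> = int (harary_coeff P G 1)"
    by (simp add: falling_factorial_poly_def)
  finally show ?thesis .
qed

lemma harary_polynomial_values: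
  assumes "is_harary_polynomial F" "Digraph.graph G" "verts G \<noteq> {}"
  shows "poly (F G) 0 = 0" "poly (F G) 1 \<in> {0, 1}"
proof -
  interpret Digraph.graph G by fact
  obtain P where P: "F G = harary_poly P G"
    using assms unfolding is_harary_polynomial_def by metis
  show "poly (F G) 0 = 0"
    using assms(3) by (simp add: P poly_harary_poly_0)
  show "poly (F G) 1 \<in> {0, 1}"
    using poly_harary_poly_1[OF finite_verts assms(3), of P] harary_coeff_1_le[of P G]
    by (auto simp: P)
qed

definition K2 :: nat_graph where
  "K2 = \<lparr>verts = {0, 1}, arcs = {(0, 1), (1, 0)}, tail = fst, head = snd\<rparr>"

lemma verts_K2: "verts K2 = {0, 1}"
  by (simp add: K2_def)

lemma adjacent_K2: "u \<rightarrow>\<^bsub>K2\<^esub> v \<longleftrightarrow> (u, v) \<in> {(0, 1), (1, 0)}"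
  by (auto simp: K2_def arcs_ends_def arc_to_ends_def)

lemma graph_K2: "Digraph.graph K2"
proof
  show "symmetric K2"
    unfolding symmetric_def by (rule symI) (auto simp: adjacent_K2)
qed (auto simp: K2_def arc_to_ends_def)

lemma not_harary_polynomial:
  assumes "poly (F K2) 0 \<noteq> 0 \<or> poly (F K2) 1 \<notin> {0, 1}"
  shows "\<not> is_harary_polynomial F"
  using harary_polynomial_values[of F K2] graph_K2 verts_K2 assms by auto

lemma vertex_list_K2: "vertex_list K2 = [0, 1]"
  by (simp add: vertex_list_def verts_K2)

lemma adjacency_mat_K2:
  "adjacency_mat K2 = mat 2 2 (\<lambda>(i, j). if i = j then 0 else 1)"
  by (rule eq_matI)
    (auto simp: adjacency_mat_def verts_K2 vertex_list_K2 adjacent_K2 less_2_cases_iff)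

lemma out_degree_K2:
  assumes "v \<in> verts K2"
  shows "out_degree K2 v = 1"
proof -
  \<comment> \<open>On the vertices 0 and 1, \<open>1 - v\<close> is the other endpoint.\<close>
  have "out_arcs K2 v = {(v, 1 - v)}"
    using assms by (auto simp: out_arcs_def K2_def)
  then show ?thesis
    by (simp add: out_degree_def)
qed

lemma laplacian_mat_K2:
  "laplacian_mat K2 = mat 2 2 (\<lambda>(i, j). if i = j then 1 else - 1)"
  by (rule eq_matI)
    (auto simp: laplacian_mat_def degree_mat_def adjacency_mat_K2 verts_K2 vertex_list_K2
      out_degree_K2 less_2_cases_iff)

lemma det_dim_2:
  fixes A :: "'a :: comm_ring_1 mat"
  assumes "A \<in> carrier_mat 2 2"
  shows "det A = A $$ (0,0) * A $$ (1,1) - A $$ (0,1) * A $$ (1,0)"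
proof -
  \<comment> \<open>The minors in the expansion along row 0 are 1 by 1.\<close>
  have "det (mat_delete A 0 j) = mat_delete A 0 j $$ (0,0)" for j
    using mat_delete_carrier[OF assms] by (intro det_single) simp
  then show ?thesis
    using laplace_expansion_row[OF assms, of 0] assms
    by (simp add: numeral_2_eq_2 cofactor_def mat_delete_def)
qed

text \<open>The off-diagonal entries of the characteristic matrix are negated, but the two signs
  cancel in their product.\<close>

lemma poly_char_poly_dim_2:
  fixes A :: "'a :: comm_ring_1 mat"
  assumes "A \<in> carrier_mat 2 2"
  shows "poly (char_poly A) x = (x - A $$ (0,0)) * (x - A $$ (1,1)) - A $$ (0,1) * A $$ (1,0)"
  using assms by (simp add: char_poly_def char_poly_matrix_def det_dim_2 algebra_simps)

lemma poly_characteristic_poly_K2: "poly (characteristic_poly K2) 0 = - 1"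
  by (simp add: characteristic_poly_def adjacency_mat_K2 poly_char_poly_dim_2)

text \<open>Here the polynomial is (x - 1)^2 - 1. It vanishes at 0, so the value at 1 has to give
  the contradiction.\<close>

lemma poly_laplacian_poly_K2: "poly (laplacian_poly K2) 1 = - 1"
  by (simp add: laplacian_poly_def laplacian_mat_K2 poly_char_poly_dim_2)

lemma undirected_edges_K2: "undirected_edges K2 = {{0, 1}}"
  by (auto simp: undirected_edges_def adjacent_K2)

text \<open>The matchings are the empty one and the single edge. The range \<open>i \<le> 1\<close>
  covers all indices in both matching polynomials of \<open>K2\<close>.\<close>

lemma matching_count_K2:
  assumes "i \<le> 1"
  shows "matching_count K2 i = 1"
proof -
  have "{M. M \<subseteq> undirected_edges K2 \<and> disjoint M \<and> card M = i} =
      {if i = 0 then {} else {{0, 1}}}"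
    using assms by (auto simp: undirected_edges_K2 subset_singleton_iff)
  then show ?thesis
    by (simp add: matching_count_def)
qed

lemma poly_generating_matching_poly_K2: "poly (generating_matching_poly K2) 0 = 1"
  by (simp add: generating_matching_poly_def undirected_edges_K2 matching_count_K2 poly_monom)

text \<open>The perfect matching supplies the constant term of x^2 - 1.\<close>

lemma poly_matching_defect_poly_K2: "poly (matching_defect_poly K2) 0 = - 1"
  by (simp add: matching_defect_poly_def verts_K2 matching_count_K2 poly_monom)

text \<open>The constant term counts the empty set alone; finiteness rules out infinite sets of
  \<open>card\<close> 0.\<close>

lemma poly_independence_poly_0:
  assumes "finite (verts G)"
  shows "poly (independence_poly G) 0 = 1"
proof -
  have "{S. independent_set G S \<and> card S = 0} = {{}}"
    using assms by (auto simp: independent_set_def dest: finite_subset)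
  then show ?thesis
    by (simp add: independence_poly_def poly_sum poly_monom power_0_left if_distrib sum.delta
        cong: if_cong)
qed

text \<open>The value at 1 counts all dominating sets, which are the three nonempty vertex sets; the
  polynomial is x^2 + 2 x.\<close>

lemma poly_domination_poly_K2: "poly (domination_poly K2) 1 = 3"
proof -
  have "\<not> dominating_set K2 {}"
    by (auto simp: dominating_set_def verts_K2)
  moreover have "finite S" if "dominating_set K2 S" for S
    using that finite_subset by (auto simp: dominating_set_def verts_K2)
  ultimately have "{S. dominating_set K2 S \<and> card S = 0} = {}"
    by (force simp: card_gt_0_iff)
  then have 0: "card {S. dominating_set K2 S \<and> card S = 0} = 0"
    by (simp only: card.empty)
  have "{S. dominating_set K2 S \<and> card S = 1} = {{0}, {1}}"
    by (auto simp: dominating_set_def verts_K2 adjacent_K2 card_1_singleton_iff)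
  then have 1: "card {S. dominating_set K2 S \<and> card S = 1} = 2"
    by simp
  have "{S. dominating_set K2 S \<and> card S = 2} = {{0, 1}}"
    by (auto simp: dominating_set_def verts_K2 adjacent_K2 card_2_iff)
  then have 2: "card {S. dominating_set K2 S \<and> card S = 2} = 1"
    by simp
  have "{..card (verts K2)} = {0, 1, 2}"
    by (auto simp: verts_K2)
  then have "poly (domination_poly K2) 1 =
      (\<Sum>i\<in>{0, 1, 2}. int (card {S. dominating_set K2 S \<and> card S = i}))"
    by (simp only: domination_poly_def poly_sum poly_monom power_one mult_1_right)
  also have "\<dots> = 3"
    using 0 1 2 by simp
  finally show ?thesis .
qed

theorem theorem6:
  shows "\<not> is_harary_polynomial characteristic_poly \<and>
         \<not> is_harary_polynomial laplacian_poly \<and>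
         \<not> is_harary_polynomial generating_matching_poly \<and>
         \<not> is_harary_polynomial matching_defect_poly \<and>
         \<not> is_harary_polynomial independence_poly \<and>
         \<not> is_harary_polynomial domination_poly"
  by (intro conjI not_harary_polynomial)
    (simp_all add: poly_characteristic_poly_K2 poly_laplacian_poly_K2
      poly_generating_matching_poly_K2 poly_matching_defect_poly_K2
      poly_independence_poly_0 poly_domination_poly_K2 verts_K2)

end
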